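(* Let $k=\mathbb F_q$ be a finite field with $q$ elements, $n\ge 0$ an integer, and $a,b\in\mathbb Z$. Let $A^{P_n}_{a,b}=|Gr_{(a,b)}(P_n)|$ be the number of submodules of dimension vector $(a,b)$ of the indecomposable preprojective Kronecker module $P_n$ of dimension vector $(n+1,n)$ over $k$. Then $$A^{P_n}_{a,b}=\begin{cases}0 & \text{if } a<0 \text{ or } b<0,\\ 1 & \text{if } a=b=0,\\ G^{n+1-a}_{n+1-b}(q)\,G^{a-b-1}_{a-1}(q) & \text{otherwise.}\end{cases}$$
   Context: A Kronecker module over $k$ is a representation $V=(V_1,V_2;\alpha,\beta)$ consisting of finite dimensional $k$-vector spaces $V_1,V_2$ and two linear maps $\alpha,\beta:V_2\to V_1$; its dimension vector is $(\dim V_1,\dim V_2)$. A submodule is a pair of subspaces $U_i\subseteq V_i$ with $\alpha(U_2)+\beta(U_2)\subseteq U_1$; its dimension vector is $(\dim U_1,\dim U_2)$. $P_n$ is, up to isomorphism, the unique indecomposable Kronecker module of dimension vector $(n+1,n)$; explicitly $V_2=k^n$, $V_1=k^{n+1}$, $\alpha(e_i)=e_i$, $\beta(e_i)=e_{i+1}$ for $1\le i\le n$. Gaussian coefficients: for $a,l\in\mathbb Z$ with $l>0$, $G^l_a(q)=\frac{(q^a-1)(q^{a-1}-1)\cdots(q^{a-l+1}-1)}{(q^l-1)\cdots(q-1)}$; $G^0_a(q)=1$; $G^{l}_a(q)=0$ for $l<0$. The lower index $a$ may be negative. *)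

theory Defs
  imports Complex_Main "HOL-Library.Cardinality" "HOL-Library.Function_Algebras"
    "HOL-Library.Set_Algebras"
begin

text \<open>The spaces \<open>V\<^sub>1\<close>, \<open>V\<^sub>2\<close> are subspaces of ambient vector spaces, so that their dimensions may be
  arbitrary natural numbers (including zero); accordingly \<open>\<alpha>\<close> and \<open>\<beta>\<close> only need to be linear
  on \<open>V\<^sub>2\<close>.\<close>

locale kronecker_module =
  vs1: vector_space scale1 + vs2: vector_space scale2
  for scale1 :: "'k::field \<Rightarrow> 'v::ab_group_add \<Rightarrow> 'v"
    and scale2 :: "'k \<Rightarrow> 'w::ab_group_add \<Rightarrow> 'w" +
  fixes V\<^sub>1 :: "'v set" and V\<^sub>2 :: "'w set" and \<alpha> \<beta> :: "'w \<Rightarrow> 'v"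
  assumes subspace_V1: "vs1.subspace V\<^sub>1"
    and subspace_V2: "vs2.subspace V\<^sub>2"
    and fin_dim_V1: "\<exists>B. finite B \<and> V\<^sub>1 = vs1.span B"
    and fin_dim_V2: "\<exists>B. finite B \<and> V\<^sub>2 = vs2.span B"
    and alpha_mem: "x \<in> V\<^sub>2 \<Longrightarrow> \<alpha> x \<in> V\<^sub>1"
    and alpha_add: "x \<in> V\<^sub>2 \<Longrightarrow> y \<in> V\<^sub>2 \<Longrightarrow> \<alpha> (x + y) = \<alpha> x + \<alpha> y"
    and alpha_scale: "x \<in> V\<^sub>2 \<Longrightarrow> \<alpha> (scale2 c x) = scale1 c (\<alpha> x)"
    and beta_mem: "x \<in> V\<^sub>2 \<Longrightarrow> \<beta> x \<in> V\<^sub>1"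
    and beta_add: "x \<in> V\<^sub>2 \<Longrightarrow> y \<in> V\<^sub>2 \<Longrightarrow> \<beta> (x + y) = \<beta> x + \<beta> y"
    and beta_scale: "x \<in> V\<^sub>2 \<Longrightarrow> \<beta> (scale2 c x) = scale1 c (\<beta> x)"
begin

definition dim_vector :: "'v set \<times> 'w set \<Rightarrow> int \<times> int" where
  "dim_vector U = (int (vs1.dim (fst U)), int (vs2.dim (snd U)))"

definition submodule :: "'v set \<times> 'w set \<Rightarrow> bool" where
  "submodule U \<longleftrightarrow>
     vs1.subspace (fst U) \<and> fst U \<subseteq> V\<^sub>1 \<and>
     vs2.subspace (snd U) \<and> snd U \<subseteq> V\<^sub>2 \<and>
     \<alpha> ` snd U + \<beta> ` snd U \<subseteq> fst U"

definition Gr :: "int \<times> int \<Rightarrow> ('v set \<times> 'w set) set" where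
  "Gr d = {U. submodule U \<and> dim_vector U = d}"

end


text \<open>\<open>k\<^sup>m\<close> is realised as the space of functions \<^typ>\<open>nat \<Rightarrow> 'k\<close> supported on \<open>{1..m}\<close>, which
  makes sense for every \<open>m \<ge> 0\<close>.\<close>

definition vscale :: "'k::field \<Rightarrow> (nat \<Rightarrow> 'k) \<Rightarrow> (nat \<Rightarrow> 'k)" where
  "vscale c v = (\<lambda>i. c * v i)"

definition coord_space :: "nat \<Rightarrow> (nat \<Rightarrow> 'k::field) set" where
  "coord_space m = {v. \<forall>i. i \<notin> {1..m} \<longrightarrow> v i = 0}"

definition unit_vec :: "nat \<Rightarrow> (nat \<Rightarrow> 'k::field)" where
  "unit_vec i = (\<lambda>j. if j = i then 1 else 0)"

definition P_alpha :: "nat \<Rightarrow> (nat \<Rightarrow> 'k::field) \<Rightarrow> (nat \<Rightarrow> 'k)" where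
  "P_alpha n v = (\<Sum>i=1..n. vscale (v i) (unit_vec i))"

definition P_beta :: "nat \<Rightarrow> (nat \<Rightarrow> 'k::field) \<Rightarrow> (nat \<Rightarrow> 'k)" where
  "P_beta n v = (\<Sum>i=1..n. vscale (v i) (unit_vec (i + 1)))"

interpretation vs: vector_space "vscale :: 'k::field \<Rightarrow> (nat \<Rightarrow> 'k) \<Rightarrow> _"
  by unfold_locales (auto simp: vscale_def fun_eq_iff algebra_simps)

lemma sum_fun_apply: "(\<Sum>i\<in>A. f i) j = (\<Sum>i\<in>A. f i j)"
  for f :: "'b \<Rightarrow> nat \<Rightarrow> 'k::field"
  by (induction A rule: infinite_finite_induct) auto

lemma P_alpha_unit_vec: "i \<in> {1..n} \<Longrightarrow> P_alpha n (unit_vec i) = unit_vec i"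
  by (auto simp: P_alpha_def fun_eq_iff sum_fun_apply vscale_def unit_vec_def
      if_distrib[of "\<lambda>x. x * _"] cong: if_cong)

lemma P_beta_unit_vec: "i \<in> {1..n} \<Longrightarrow> P_beta n (unit_vec i) = unit_vec (i + 1)"
  by (auto simp: P_beta_def fun_eq_iff sum_fun_apply vscale_def unit_vec_def
      if_distrib[of "\<lambda>x. x * _"] cong: if_cong)

lemma subspace_coord_space: "vs.subspace (coord_space m)"
  by (auto simp: vs.subspace_def coord_space_def vscale_def)

lemma unit_vec_in_coord_space: "i \<in> {1..m} \<Longrightarrow> unit_vec i \<in> coord_space m"
  by (auto simp: coord_space_def unit_vec_def)

lemma coord_space_eq_sum:
  assumes "v \<in> coord_space m"
  shows "v = (\<Sum>i=1..m. vscale (v i) (unit_vec i))"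
  using assms
  by (auto simp: fun_eq_iff sum_fun_apply vscale_def unit_vec_def coord_space_def
      if_distrib[of "\<lambda>x. _ * x"] cong: if_cong)

lemma coord_space_eq_span:
  "coord_space m = vs.span (unit_vec ` {1..m} :: (nat \<Rightarrow> 'k::field) set)"
proof (intro subset_antisym subsetI)
  fix v :: "nat \<Rightarrow> 'k" assume "v \<in> coord_space m"
  then have "v = (\<Sum>i=1..m. vscale (v i) (unit_vec i))"
    by (rule coord_space_eq_sum)
  also have "\<dots> \<in> vs.span (unit_vec ` {1..m})"
    by (intro vs.span_sum vs.span_scale vs.span_base imageI)
  finally show "v \<in> vs.span (unit_vec ` {1..m})" .
next
  fix v :: "nat \<Rightarrow> 'k" assume "v \<in> vs.span (unit_vec ` {1..m})"
  moreover have "vs.span (unit_vec ` {1..m}) \<subseteq> (coord_space m :: (nat \<Rightarrow> 'k) set)"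
    by (intro vs.span_minimal subspace_coord_space) (auto intro: unit_vec_in_coord_space)
  ultimately show "v \<in> coord_space m" by auto
qed

lemma unit_vec_inject: "unit_vec i = (unit_vec j :: nat \<Rightarrow> 'k::field) \<longleftrightarrow> i = j"
  by (auto simp: unit_vec_def fun_eq_iff split: if_splits)

lemma independent_unit_vec:
  "vs.independent (unit_vec ` {1..m} :: (nat \<Rightarrow> 'k::field) set)"
proof (rule vs.independent_if_scalars_zero)
  fix f :: "(nat \<Rightarrow> 'k) \<Rightarrow> 'k" and x :: "nat \<Rightarrow> 'k"
  assume 0: "(\<Sum>x\<in>unit_vec ` {1..m}. vscale (f x) x) = 0" and "x \<in> unit_vec ` {1..m}"
  then obtain j where j: "x = unit_vec j" "j \<in> {1..m}" by auto
  have "0 = (\<Sum>i=1..m. vscale (f (unit_vec i)) (unit_vec i))"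
    using 0 by (subst (asm) sum.reindex) (auto simp: inj_on_def unit_vec_inject)
  then have "0 = (\<Sum>i=1..m. vscale (f (unit_vec i)) (unit_vec i)) j" by simp
  also have "\<dots> = f (unit_vec j)"
    using j by (auto simp: sum_fun_apply vscale_def unit_vec_def
        if_distrib[of "\<lambda>x. _ * x"] cong: if_cong)
  finally show "f x = 0" using j by simp
qed simp

lemma dim_coord_space: "vs.dim (coord_space m :: (nat \<Rightarrow> 'k::field) set) = m"
  unfolding coord_space_eq_span vs.dim_span_eq_card_independent[OF independent_unit_vec]
  by (simp add: card_image inj_on_def unit_vec_inject)

lemma P_maps_mem:
  "P_alpha n v \<in> coord_space (n + 1)" "P_beta n v \<in> coord_space (n + 1)"
  unfolding P_alpha_def P_beta_def
  by (intro vs.subspace_sum vs.subspace_scale subspace_coord_space unit_vec_in_coord_space;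
      force)+

lemma P_maps_linear:
  "P_alpha n (v + w) = P_alpha n v + P_alpha n w" "P_alpha n (vscale c v) = vscale c (P_alpha n v)"
  "P_beta n (v + w) = P_beta n v + P_beta n w" "P_beta n (vscale c v) = vscale c (P_beta n v)"
  by (simp_all add: P_alpha_def P_beta_def fun_eq_iff sum_fun_apply vscale_def algebra_simps
      sum.distrib sum_distrib_left)

text \<open>The module \<open>P\<^sub>n\<close>: \<open>V\<^sub>1 = k\<^bsup>n+1\<^esup>\<close>, \<open>V\<^sub>2 = k\<^sup>n\<close>, \<open>\<alpha>(e\<^sub>i) = e\<^sub>i\<close>, \<open>\<beta>(e\<^sub>i) = e\<^bsub>i+1\<^esub>\<close>.\<close>

global_interpretation P: kronecker_module
  "vscale :: 'k::field \<Rightarrow> (nat \<Rightarrow> 'k) \<Rightarrow> _" "vscale :: 'k \<Rightarrow> (nat \<Rightarrow> 'k) \<Rightarrow> _"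
  "coord_space (n + 1)" "coord_space n" "P_alpha n" "P_beta n" for n :: nat
  defines P_dim_vector = "P.dim_vector" and P_submodule = "P.submodule" and P_Gr = "P.Gr"
proof unfold_locales
  show "\<exists>B. finite B \<and> coord_space (n + 1) = vs.span (B :: (nat \<Rightarrow> 'k) set)"
    "\<exists>B. finite B \<and> coord_space n = vs.span (B :: (nat \<Rightarrow> 'k) set)"
    using coord_space_eq_span by blast+
qed (simp_all only: subspace_coord_space P_maps_mem P_maps_linear)

lemma dim_vector_P:
  "P_dim_vector (coord_space (n + 1), coord_space n :: (nat \<Rightarrow> 'k::field) set) = (int n + 1, int n)"
  by (simp add: P.dim_vector_def dim_coord_space del: One_nat_def)


text \<open>Gaussian coefficient \<open>G\<^sup>l\<^sub>a(q)\<close>. For \<open>l = 0\<close> both products are empty, giving \<open>1\<close>. The exponents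
  in the numerator may be negative.\<close>

definition gaussian :: "int \<Rightarrow> int \<Rightarrow> 'f::field \<Rightarrow> 'f" where
  "gaussian l a q =
     (if l < 0 then 0
      else (\<Prod>i<nat l. q powi (a - int i) - 1) / (\<Prod>i=1..nat l. q ^ i - 1))"

end

theory Submission
  imports Defs
begin

text \<open>Identify \<open>k\<^sup>m\<close> with the polynomials of degree less than \<open>m\<close> via \<open>e\<^sub>i \<mapsto> x\<^bsup>i-1\<^esup>\<close>. A submodule of
  \<open>P\<^sub>n\<close> is then a pair \<open>(U\<^sub>1, U\<^sub>2)\<close> with \<open>U\<^sub>2 + x U\<^sub>2 \<subseteq> U\<^sub>1\<close>, equivalently with
  \<open>U\<^sub>2 \<subseteq> {v \<in> U\<^sub>1. x v \<in> U\<^sub>1}\<close>. Summing over \<open>U\<^sub>2\<close> expresses the number \<open>A\<^sub>n(a, b)\<close> of submodules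
  through the numbers \<open>N\<^sub>n(b, r)\<close> of \<open>b\<close>-dimensional \<open>U \<subseteq> k\<^sup>n\<close> with \<open>dim (U + x U) = b + r\<close>;
  summing over \<open>U\<^sub>1\<close> expresses it through the distribution of \<open>dim {v \<in> U. x v \<in> U}\<close> for
  \<open>a\<close>-dimensional \<open>U \<subseteq> k\<^bsup>n+1\<^esup>\<close>, which is \<open>N\<^bsub>n+1\<^esub>(a, _)\<close> because
  \<open>dim (U + x U) + dim {v \<in> U. x v \<in> U} = 2 dim U\<close>. The second relation can be inverted, so
  \<open>N\<^sub>n\<close> determines \<open>A\<^sub>n\<close>, which determines \<open>N\<^bsub>n+1\<^esub>\<close>, and both closed forms
  follow by induction on \<open>n\<close> from the \<open>q\<close>-Vandermonde identity.\<close>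

subsection \<open>Gaussian binomial coefficients\<close>

text \<open>Up to the factor (q-1)^n this is the usual q-factorial; these factors cancel in
  \<open>qbinom\<close>.\<close>

definition qfact :: "'a::field \<Rightarrow> nat \<Rightarrow> 'a" where
  "qfact q n = (\<Prod>i=1..n. q ^ i - 1)"

text \<open>With natural indices and value 0 for k > n, most range conditions in the sums below turn
  into vanishing terms. \<open>gaussian_eq_qbinom\<close> leads back to integer indices.\<close>

definition qbinom :: "'a::field \<Rightarrow> nat \<Rightarrow> nat \<Rightarrow> 'a" where
  "qbinom q n k = (if k \<le> n then qfact q n / (qfact q k * qfact q (n - k)) else 0)"

lemma qfact_0 [simp]: "qfact q 0 = 1"
  by (simp add: qfact_def)

lemma qfact_Suc: "qfact q (Suc n) = qfact q n * (q ^ Suc n - 1)"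
  by (simp add: qfact_def)

lemma qbinom_eq_0 [simp]: "n < k \<Longrightarrow> qbinom q n k = 0"
  by (simp add: qbinom_def)

lemma qbinom_symmetric: "k \<le> n \<Longrightarrow> qbinom q n (n - k) = qbinom q n k"
  by (simp add: qbinom_def mult.commute)

context
  fixes q :: "'a::linordered_field"
  assumes q_gt_1: "q > 1"
begin

lemma qfact_nonzero [simp]: "qfact q n \<noteq> 0"
proof -
  have "q ^ i \<noteq> 1" if "i \<ge> 1" for i
    using one_less_power[OF q_gt_1, of i] that by simp
  then show ?thesis by (auto simp: qfact_def)
qed

lemma power_neq_1: "q ^ Suc n \<noteq> 1"
  using one_less_power[OF q_gt_1, of "Suc n"] by simp

lemma qbinom_0_right [simp]: "qbinom q n 0 = 1"
  by (simp add: qbinom_def)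

lemma qbinom_self [simp]: "qbinom q n n = 1"
  by (simp add: qbinom_def)

lemma qbinom_absorption:
  "(q ^ Suc k - 1) * qbinom q (Suc n) (Suc k) = (q ^ Suc n - 1) * qbinom q n k"
  using power_neq_1[of k] by (simp add: qbinom_def qfact_Suc divide_simps del: power_Suc)

lemma qbinom_Suc_Suc:
  "qbinom q (Suc n) (Suc k) = qbinom q n k + q ^ Suc k * qbinom q n (Suc k)"
proof (cases "k < n")
  case True
  then obtain m where n: "n = Suc (k + m)"
    using less_imp_Suc_add by blast
  have *: "n - k = Suc m" "n - Suc k = m" "k \<le> n" "Suc k \<le> n" "Suc n - Suc k = Suc m"
    using n by auto
  \<comment> \<open>Splitting the top factor of \<open>qfact q (Suc n)\<close> in this way produces
    the two summands of the q-Pascal rule.\<close>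
  have "q ^ Suc n - 1 = (q ^ Suc k - 1) + q ^ Suc k * (q ^ Suc m - 1)"
    by (simp add: n power_add algebra_simps)
  then have "qbinom q (Suc n) (Suc k) =
      qfact q n * ((q ^ Suc k - 1) + q ^ Suc k * (q ^ Suc m - 1)) /
      (qfact q k * (q ^ Suc k - 1) * (qfact q m * (q ^ Suc m - 1)))"
    unfolding qbinom_def * by (simp add: qfact_Suc * del: power_Suc)
  then show ?thesis
    using power_neq_1[of k] power_neq_1[of m] *
    by (simp add: qbinom_def qfact_Suc distrib_left add_divide_distrib mult_ac del: power_Suc)
qed (auto simp: qbinom_def)

lemma qbinom_trinomial_revision:
  assumes "r \<le> s"
  shows "qbinom q n s * qbinom q s r = qbinom q n r * qbinom q (n - r) (s - r)"
proof (cases "s \<le> n")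
  case True
  with assms show ?thesis by (simp add: qbinom_def)
next
  case False
  with assms show ?thesis by (cases "r \<le> n") auto
qed

text \<open>The truncated difference in the exponent is harmless: \<open>qbinom q m (k - j)\<close> vanishes
  whenever it is cut off.\<close>

lemma qbinom_Vandermonde:
  "qbinom q (m + n) k =
    (\<Sum>j\<le>k. q ^ (j * (m - (k - j))) * qbinom q m (k - j) * qbinom q n j)"
proof (induction m arbitrary: k)
  case 0
  have "(\<Sum>j\<le>k. q ^ (j * (0 - (k - j))) * qbinom q 0 (k - j) * qbinom q n j) =
      (\<Sum>j\<le>k. if j = k then qbinom q n k else 0)"
    by (rule sum.cong) auto
  then show ?case by simp
next
  case (Suc m)
  show ?case
  proof (cases k)
    case 0
    then show ?thesis by simp
  next
    case (Suc l)
    \<comment> \<open>By the q-Pascal rule the first part of each term belongs to the sum for l = k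
      - 1, the second is q^k times a term of the sum for k. At j = k the lower index is 0 and only
      the second part remains.\<close>
    have *: "q ^ (j * (Suc m - (k - j))) * qbinom q (Suc m) (k - j) =
        (if j \<le> l then q ^ (j * (m - (l - j))) * qbinom q m (l - j) else 0)
        + q ^ k * (q ^ (j * (m - (k - j))) * qbinom q m (k - j))" if "j \<le> k" for j
    proof (cases "j \<le> l")
      case True
      then have kj: "k - j = Suc (l - j)" using Suc by simp
      have "q ^ (j * (m - (l - j))) * (q ^ Suc (l - j) * qbinom q m (Suc (l - j))) =
        q ^ k * (q ^ (j * (m - Suc (l - j))) * qbinom q m (Suc (l - j)))"
      proof (cases "Suc (l - j) \<le> m")
        case le: True
        then obtain t where m: "m = Suc (l - j) + t"
          using le_iff_add by blast
        have "k = Suc (l - j) + j"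
          using True Suc by simp
        then have "j * (m - (l - j)) + Suc (l - j) = k + j * (m - Suc (l - j))"
          by (simp add: m)
        then show ?thesis by (simp flip: power_add mult.assoc del: power_Suc)
      qed simp
      then show ?thesis using True
        by (simp add: kj qbinom_Suc_Suc distrib_left del: power_Suc)
    next
      case False
      then have "j = k" using that Suc by simp
      with Suc show ?thesis by (simp add: power_add mult.commute)
    qed
    have "(\<Sum>j\<le>k. q ^ (j * (Suc m - (k - j))) * qbinom q (Suc m) (k - j) * qbinom q n j) =
       (\<Sum>j\<le>k. if j \<le> l then q ^ (j * (m - (l - j))) * qbinom q m (l - j) * qbinom q n j else 0)
       + q ^ k * (\<Sum>j\<le>k. q ^ (j * (m - (k - j))) * qbinom q m (k - j) * qbinom q n j)"
      unfolding sum_distrib_left sum.distrib[symmetric]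
      by (intro sum.cong refl, subst * ) (auto simp: distrib_right mult.assoc)
    also have "(\<Sum>j\<le>k. if j \<le> l then q ^ (j * (m - (l - j))) * qbinom q m (l - j) * qbinom q n j
        else 0) = (\<Sum>j\<le>l. q ^ (j * (m - (l - j))) * qbinom q m (l - j) * qbinom q n j)"
      using Suc by simp
    finally show ?thesis
      by (simp only: Suc.IH[symmetric] Suc add_Suc qbinom_Suc_Suc)
  qed
qed

text \<open>For k \<le> n the numerator is \<open>qfact q n\<close> with the factors of
  \<open>qfact q (n - k)\<close> removed. For k > n it contains the factor q^0 - 1 at i = n.\<close>

lemma gaussian_eq_qbinom: "gaussian (int k) (int n) q = qbinom q n k"
proof (cases "k \<le> n")
  case True
  have "(\<Prod>i<k. q powi (int n - int i) - 1) * qfact q (n - k) = qfact q n" if "k \<le> n" for k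
    using that
  proof (induction k)
    case (Suc k)
    then have nk: "n - k = Suc (n - Suc k)" and "int n - int k = int (Suc (n - Suc k))" by auto
    then have "q powi (int n - int k) = q ^ Suc (n - Suc k)"
      by (simp only: power_int_of_nat)
    with Suc nk show ?case by (simp add: qfact_Suc algebra_simps del: power_Suc)
  qed simp
  from this[OF True] show ?thesis
    using True by (simp add: gaussian_def qbinom_def qfact_def[of q k, symmetric, simplified] divide_simps)
next
  case False
  then have "(\<Prod>i<k. q powi (int n - int i) - 1) = 0"
    by (intro prod_zero) (auto intro!: bexI[of _ n])
  with False show ?thesis by (simp add: gaussian_def)
qed

text \<open>The matrix of the \<open>qbinom q d b\<close> is triangular with ones on the diagonal,
  so the transform can be inverted; the induction descends from d = a.\<close>

lemma qbinom_transform_inject: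
  fixes f g :: "nat \<Rightarrow> 'a"
  assumes "\<And>b. (\<Sum>d\<le>a. f d * qbinom q d b) = (\<Sum>d\<le>a. g d * qbinom q d b)" and "d \<le> a"
  shows "f d = g d"
  using assms(2)
proof (induction "a - d" arbitrary: d rule: less_induct)
  case less
  have split: "(\<Sum>e\<le>a. h e * qbinom q e d) = h d + (\<Sum>e\<in>{d<..a}. h e * qbinom q e d)"
    for h :: "nat \<Rightarrow> 'a"
  proof -
    have "(\<Sum>e\<le>a. h e * qbinom q e d) = (\<Sum>e\<in>{d..a}. h e * qbinom q e d)"
      by (rule sum.mono_neutral_right) auto
    also have "\<dots> = h d + (\<Sum>e\<in>{d<..a}. h e * qbinom q e d)"
      using less.prems by (subst sum.head) auto
    finally show ?thesis .
  qed
  have "(\<Sum>e\<in>{d<..a}. f e * qbinom q e d) = (\<Sum>e\<in>{d<..a}. g e * qbinom q e d)"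
    by (rule sum.cong) (use less.hyps in auto)
  with assms(1)[of d] show ?case by (simp add: split)
qed

end

subsection \<open>Counting subspaces over a finite field\<close>

lemma card_field_gt_1: "CARD('k::{field,finite}) > 1"
proof -
  have "card {0, 1::'k} \<le> CARD('k)" by (rule card_mono) auto
  then show ?thesis by simp
qed

locale finite_field_vector_space = vector_space scale
  for scale :: "'k::{field,finite} \<Rightarrow> 'v::ab_group_add \<Rightarrow> 'v"
begin

lemma card_span_insert:
  assumes "v \<notin> span S"
  shows "card (span (insert v S)) = CARD('k) * card (span S)"
proof -
  have "bij_betw (\<lambda>(c, s). scale c v + s) (UNIV \<times> span S) (span (insert v S))"
    unfolding bij_betw_def
  proof
    show "inj_on (\<lambda>(c, s). scale c v + s) (UNIV \<times> span S)"
    proof (clarsimp simp: inj_on_def)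
      fix c s d t assume st: "s \<in> span S" "t \<in> span S" and eq: "scale c v + s = scale d v + t"
      then have "scale (c - d) v = t - s"
        by (simp add: scale_left_diff_distrib algebra_simps)
      then have "scale (c - d) v \<in> span S" using st by (simp add: span_diff)
      then have "c = d" using assms span_scale[of "scale (c - d) v" S "inverse (c - d)"]
        by (cases "c = d") auto
      with eq show "c = d \<and> s = t" by simp
    qed
    show "(\<lambda>(c, s). scale c v + s) ` (UNIV \<times> span S) = span (insert v S)"
    proof (intro subset_antisym subsetI)
      fix x assume "x \<in> span (insert v S)"
      then obtain k where "x - scale k v \<in> span S" by (auto simp: span_insert)
      then show "x \<in> (\<lambda>(c, s). scale c v + s) ` (UNIV \<times> span S)"
        by (intro image_eqI[of _ _ "(k, x - scale k v)"]) auto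
    next
      fix x assume "x \<in> (\<lambda>(c, s). scale c v + s) ` (UNIV \<times> span S)"
      then obtain c s where "s \<in> span S" "x = scale c v + s" by auto
      then show "x \<in> span (insert v S)" by (auto simp: span_insert intro!: exI[of _ c])
    qed
  qed
  then show ?thesis by (simp add: bij_betw_same_card[symmetric] card_cartesian_product)
qed

lemma card_span_independent:
  assumes "finite B" "independent B"
  shows "card (span B) = CARD('k) ^ card B"
  using assms
  by (induction B) (auto simp: card_span_insert independent_insert)

text \<open>The bridge from counting to dimension: the facts on dimensions below are obtained by
  comparing powers of \<open>CARD('k)\<close>.\<close>

lemma card_subspace:
  assumes "subspace U" "finite U"
  shows "card U = CARD('k) ^ dim U"
proof -
  obtain B where B: "B \<subseteq> U" "independent B" "U \<subseteq> span B" "card B = dim U"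
    using basis_exists by blast
  then have "U = span B" using assms span_minimal by blast
  with B assms show ?thesis using card_span_independent finite_subset by metis
qed

lemma dim_eqI:
  assumes "subspace U" "finite U" "card U = CARD('k) ^ d"
  shows "dim U = d"
  using assms card_subspace[of U] card_field_gt_1[where 'k='k] by simp

lemma subspace_eqI_dim:
  assumes "subspace S" "subspace U" "finite U" "S \<subseteq> U" "dim S = dim U"
  shows "S = U"
  using assms card_subspace[of S] card_subspace[of U] finite_subset[of S U]
  by (intro card_subset_eq) auto

lemma dim_mono_finite:
  assumes "subspace S" "subspace U" "finite U" "S \<subseteq> U"
  shows "dim S \<le> dim U"
  using card_mono[OF assms(3,4)] card_subspace[of S] card_subspace[of U] assms
    finite_subset[of S U] card_field_gt_1[where 'k='k] by auto

text \<open>Pairs \<open>(v, U)\<close> with \<open>v \<in> U - S\<close> are counted in two ways; adjoining \<open>v\<close> to \<open>S\<close> raises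
  the dimension of the lower bound.\<close>

lemma card_subspaces_between:
  assumes "subspace S" "subspace V" "finite V" "S \<subseteq> V" "dim S \<le> a"
  shows "(of_nat (card {U. subspace U \<and> S \<subseteq> U \<and> U \<subseteq> V \<and> dim U = a}) :: rat) =
    qbinom (of_nat CARD('k)) (dim V - dim S) (a - dim S)"
  using assms
proof (induction "a - dim S" arbitrary: S)
  case 0
  then have "{U. subspace U \<and> S \<subseteq> U \<and> U \<subseteq> V \<and> dim U = a} = {S}"
    by (intro set_eqI) (use subspace_eqI_dim[OF 0(2) _ finite_subset[OF _ 0(4)]] in force)
  then show ?case using "0.hyps" card_field_gt_1[where 'k='k] by simp
next
  case (Suc k)
  let ?q = "of_nat CARD('k) :: rat"
  define X where "X S = {U. subspace U \<and> S \<subseteq> U \<and> U \<subseteq> V \<and> dim U = a}" for S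
  have q: "?q > 1" using card_field_gt_1[where 'k='k] by simp
  have fin: "finite S" using Suc.prems finite_subset by blast
  have finX: "finite (X S)" by (rule finite_subset[of _ "Pow V"]) (auto simp: X_def Suc.prems)
  have a: "a = Suc (dim S + k)" using Suc by simp
  have diff: "of_nat (card (U - S)) = ?q ^ dim S * (?q ^ (dim U - dim S) - 1)"
    if "subspace U" "S \<subseteq> U" "U \<subseteq> V" for U
  proof -
    have finU: "finite U" using that Suc.prems finite_subset by blast
    have le: "dim S \<le> dim U" using dim_mono_finite that finU Suc.prems by blast
    have "(of_nat (card (U - S)) :: rat) = of_nat (card U) - of_nat (card S)"
      using that finU fin by (simp add: card_Diff_subset card_mono of_nat_diff)
    also have "\<dots> = ?q ^ dim U - ?q ^ dim S"
      using that finU fin Suc.prems by (simp add: card_subspace)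
    finally show ?thesis
      using le by (simp add: right_diff_distrib flip: power_add)
  qed
  \<comment> \<open>The pairs (v, U) are summed over U first; swapping the sums then fixes
    v.\<close>
  have "of_nat (card (X S)) * (?q ^ dim S * (?q ^ Suc k - 1)) =
      (\<Sum>U\<in>X S. \<Sum>v | v \<in> V - S \<and> v \<in> U. 1)"
  proof -
    have "(\<Sum>v | v \<in> V - S \<and> v \<in> U. 1) = ?q ^ dim S * (?q ^ Suc k - 1)" if "U \<in> X S" for U
    proof -
      have "{v. v \<in> V - S \<and> v \<in> U} = U - S" using that by (auto simp: X_def)
      with diff[of U] that a show ?thesis by (auto simp: X_def simp del: power_Suc)
    qed
    then show ?thesis by simp
  qed
  also have "\<dots> = (\<Sum>v\<in>V - S. \<Sum>U | U \<in> X S \<and> v \<in> U. 1)"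
    by (rule sum.swap_restrict) (use finX Suc.prems in auto)
  also have "\<dots> = (\<Sum>v\<in>V - S. qbinom ?q (dim V - Suc (dim S)) k)"
  proof (rule sum.cong)
    fix v assume v: "v \<in> V - S"
    define T where "T = span (insert v S)"
    have "T \<subseteq> V"
      using v Suc.prems unfolding T_def by (intro span_minimal) auto
    then have T: "subspace T" "T \<subseteq> V" "S \<subseteq> T" "finite T"
      using span_superset[of "insert v S"] finite_subset[OF _ \<open>finite V\<close>] by (auto simp: T_def)
    have S: "span S = S" using Suc.prems by simp
    with v have "v \<notin> span S" by (simp only:) simp
    from card_span_insert[OF this] have "card T = CARD('k) * card S"
      by (simp only: T_def S)
    then have "card T = CARD('k) ^ Suc (dim S)"
      using Suc.prems fin by (simp add: card_subspace)
    then have dimT: "dim T = Suc (dim S)" using T by (intro dim_eqI)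
    \<comment> \<open>For fixed v the admissible U are those above T, which has dimension one more
      than S, so the induction hypothesis counts them.\<close>
    have "{U. U \<in> X S \<and> v \<in> U} = X T"
    proof -
      have "T \<subseteq> U \<longleftrightarrow> S \<subseteq> U \<and> v \<in> U" if "subspace U" for U
        using that span_minimal[of "insert v S" U] span_superset[of "insert v S"]
        by (auto simp: T_def)
      then show ?thesis by (auto simp: X_def)
    qed
    then show "(\<Sum>U | U \<in> X S \<and> v \<in> U. 1) = qbinom ?q (dim V - Suc (dim S)) k"
      using Suc.hyps(1)[of T] T Suc.prems a dimT by (simp add: X_def)
  qed simp
  also have "\<dots> = ?q ^ dim S * (?q ^ (dim V - dim S) - 1) * qbinom ?q (dim V - Suc (dim S)) k"
    using diff[of V] Suc.prems by simp
  finally have "(?q ^ Suc k - 1) * of_nat (card (X S)) =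
      (?q ^ (dim V - dim S) - 1) * qbinom ?q (dim V - Suc (dim S)) k"
    using q by (simp add: mult.assoc mult.left_commute mult.commute[of "of_nat (card _)"] del: power_Suc)
  also have "\<dots> = (?q ^ Suc k - 1) * qbinom ?q (dim V - dim S) (Suc k)"
  proof (cases "dim V - dim S")
    case (Suc m)
    then have "dim V - Suc (dim S) = m" by simp
    then show ?thesis using Suc qbinom_absorption[OF q, of k m] by simp
  qed simp
  finally show ?case
    using power_neq_1[OF q, of k] Suc.hyps(2) by (simp add: X_def del: power_Suc)
qed

lemma card_subspaces:
  assumes "subspace V" "finite V"
  shows "(of_nat (card {U. subspace U \<and> U \<subseteq> V \<and> dim U = a}) :: rat) =
    qbinom (of_nat CARD('k)) (dim V) a"
proof -
  have "{U. subspace U \<and> U \<subseteq> V \<and> dim U = a} = {U. subspace U \<and> {0} \<subseteq> U \<and> U \<subseteq> V \<and> dim U = a}"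
    using subspace_0 by auto
  moreover have "dim {0} = 0" by (rule dim_eqI) auto
  ultimately show ?thesis
    using card_subspaces_between[of "{0}" V a] assms subspace_0[of V] by simp
qed

end

subsection \<open>Multiplication by the variable\<close>

global_interpretation vs: finite_field_vector_space
  "vscale :: 'k::{field,finite} \<Rightarrow> (nat \<Rightarrow> 'k) \<Rightarrow> _"
  by unfold_locales

text \<open>Multiplication by x. Because of truncated subtraction coordinate 0 is kept as well as
  copied to 1; this is harmless, since vectors of \<open>coord_space\<close> vanish there.\<close>

definition shift :: "(nat \<Rightarrow> 'k) \<Rightarrow> nat \<Rightarrow> 'k" where
  "shift v = (\<lambda>i. v (i - 1))"

lemma shift_linear:
  "shift (v + w) = shift v + shift w" "shift (v - w) = shift v - shift w"
  "shift (vscale c v) = vscale c (shift v)" "shift 0 = (0 :: nat \<Rightarrow> 'k::field)"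
  by (simp_all add: shift_def vscale_def fun_eq_iff)

lemma P_alpha_eq: "v \<in> coord_space n \<Longrightarrow> P_alpha n v = v"
  unfolding P_alpha_def by (rule coord_space_eq_sum[symmetric])

lemma P_beta_eq:
  assumes "v \<in> coord_space n"
  shows "P_beta n v = shift v"
proof
  fix j
  show "P_beta n v j = shift v j"
  proof (cases j)
    case 0
    with assms show ?thesis
      by (simp add: P_beta_def sum_fun_apply vscale_def unit_vec_def shift_def coord_space_def)
  next
    case (Suc i)
    with assms show ?thesis
      by (auto simp: P_beta_def sum_fun_apply vscale_def unit_vec_def shift_def coord_space_def
          if_distrib[of "\<lambda>x. _ * x"] cong: if_cong)
  qed
qed

definition expand :: "(nat \<Rightarrow> 'k::field) set \<Rightarrow> (nat \<Rightarrow> 'k) set" where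
  "expand U = U + shift ` U"

definition contract :: "(nat \<Rightarrow> 'k::field) set \<Rightarrow> (nat \<Rightarrow> 'k) set" where
  "contract U = {v \<in> U. shift v \<in> U}"

lemma subspace_contract: "vs.subspace U \<Longrightarrow> vs.subspace (contract U)"
  by (auto simp: vs.subspace_def contract_def shift_linear)

lemma subspace_expand:
  assumes "vs.subspace U"
  shows "vs.subspace (expand U)"
proof -
  have "vs.subspace (shift ` U)"
  proof (rule vs.subspaceI)
    show "0 \<in> shift ` U"
      using vs.subspace_0[OF assms] by (rule rev_image_eqI) (simp add: shift_linear)
    show "x + y \<in> shift ` U" if "x \<in> shift ` U" "y \<in> shift ` U" for x y
      using that vs.subspace_add[OF assms] by (metis (no_types) imageE imageI shift_linear(1))
    show "vscale c x \<in> shift ` U" if "x \<in> shift ` U" for c x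
      using that vs.subspace_scale[OF assms] by (metis (no_types) imageE imageI shift_linear(3))
  qed
  from vs.subspace_sums[OF assms this] show ?thesis
    by (rule back_subst[of vs.subspace]) (auto simp: expand_def set_plus_def)
qed

lemma expand_subset_iff:
  assumes "vs.subspace U" "vs.subspace W"
  shows "expand U \<subseteq> W \<longleftrightarrow> U \<subseteq> contract W"
proof
  assume *: "expand U \<subseteq> W"
  show "U \<subseteq> contract W"
  proof
    fix v assume v: "v \<in> U"
    have "v + shift 0 \<in> expand U" "0 + shift v \<in> expand U"
      unfolding expand_def using v vs.subspace_0[OF assms(1)] by blast+
    with * show "v \<in> contract W"
      by (auto simp: contract_def shift_linear)
  qed
next
  assume "U \<subseteq> contract W"
  show "expand U \<subseteq> W"
  proof
    fix x assume "x \<in> expand U"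
    then obtain u v where "u \<in> U" "v \<in> U" "x = u + shift v"
      unfolding expand_def by (blast elim: set_plus_elim)
    with \<open>U \<subseteq> contract W\<close> have "u \<in> W" "shift v \<in> W"
      by (auto simp: contract_def)
    with \<open>x = u + shift v\<close> show "x \<in> W"
      by (simp only: vs.subspace_add[OF assms(2)])
  qed
qed

lemma finite_coord_space [simp]: "finite (coord_space m :: (nat \<Rightarrow> 'k::{field,finite}) set)"
proof (rule card_ge_0_finite)
  have "card (coord_space m :: (nat \<Rightarrow> 'k) set) = CARD('k) ^ card (unit_vec ` {1..m} :: (nat \<Rightarrow> 'k) set)"
    unfolding coord_space_eq_span
    by (intro vs.card_span_independent finite_imageI finite_atLeastAtMost independent_unit_vec)
  then show "0 < card (coord_space m :: (nat \<Rightarrow> 'k) set)"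
    by (simp add: card_gt_0_iff)
qed

lemma contract_coord_space: "contract (coord_space (n + 1)) = (coord_space n :: (nat \<Rightarrow> 'k::field) set)"
proof (intro subset_antisym subsetI)
  fix v :: "nat \<Rightarrow> 'k" assume v: "v \<in> contract (coord_space (n + 1))"
  show "v \<in> coord_space n"
    unfolding coord_space_def
  proof (clarify, rule ccontr)
    fix i assume i: "i \<notin> {1..n}" "v i \<noteq> 0"
    \<comment> \<open>A nonzero top coordinate n + 1 of v would reappear as coordinate n + 2 of
      \<open>shift v\<close>, outside the space.\<close>
    with v have "i = n + 1" by (auto simp: contract_def coord_space_def not_le le_Suc_eq)
    moreover have "shift v (n + 2) = 0" using v by (auto simp: contract_def coord_space_def)
    ultimately show False using i by (simp add: shift_def)
  qed
next
  fix v :: "nat \<Rightarrow> 'k" assume "v \<in> coord_space n"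
  then have v: "v i = 0" if "i \<notin> {1..n}" for i
    using that by (simp add: coord_space_def)
  have "v (i - 1) = 0" if "i \<notin> {1..n + 1}" for i
    using that by (cases i) (auto intro!: v)
  moreover have "v i = 0" if "i \<notin> {1..n + 1}" for i
    using that by (intro v) auto
  ultimately show "v \<in> contract (coord_space (n + 1))"
    by (simp add: contract_def coord_space_def shift_def)
qed

lemma contract_subset_coord_space:
  assumes "U \<subseteq> coord_space (n + 1)"
  shows "contract U \<subseteq> coord_space n"
proof -
  have "contract U \<subseteq> contract (coord_space (n + 1))"
    using assms unfolding contract_def by blast
  then show ?thesis by (simp only: contract_coord_space)
qed

lemma expand_subset_coord_space:
  "vs.subspace U \<Longrightarrow> U \<subseteq> coord_space n \<Longrightarrow> expand U \<subseteq> coord_space (n + 1)"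
  by (simp only: expand_subset_iff[OF _ subspace_coord_space] contract_coord_space)

text \<open>The fibres of \<open>(u, v) \<mapsto> u + shift v\<close> on \<open>U \<times> U\<close> are the translates of
  \<open>{(shift d, - d) | d \<in> contract U}\<close>.\<close>

lemma dim_expand_plus_dim_contract:
  fixes U :: "(nat \<Rightarrow> 'k::{field,finite}) set"
  assumes U: "vs.subspace U" and fin: "finite U"
  shows "vs.dim (expand U) + vs.dim (contract U) = 2 * vs.dim U"
proof -
  let ?f = "\<lambda>(u, v). u + shift v :: nat \<Rightarrow> 'k"
  have fibre: "card {p \<in> U \<times> U. ?f p = e} = card (contract U)" if "e \<in> expand U" for e
  proof -
    obtain u v where uv: "u \<in> U" "v \<in> U" "e = u + shift v"
      using \<open>e \<in> expand U\<close> by (auto simp: expand_def elim!: set_plus_elim)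
    have "{p \<in> U \<times> U. ?f p = e} = (\<lambda>d. (u + shift d, v - d)) ` contract U"
    proof (intro subset_antisym subsetI)
      fix p assume p: "p \<in> {p \<in> U \<times> U. ?f p = e}"
      then obtain x y where xy: "p = (x, y)" "x \<in> U" "y \<in> U" "x + shift y = u + shift v"
        using uv by auto
      then have "shift (v - y) = x - u" by (simp add: shift_linear algebra_simps)
      with xy uv U have "v - y \<in> contract U" "p = (u + shift (v - y), v - (v - y))"
        by (auto simp: contract_def vs.subspace_diff)
      then show "p \<in> (\<lambda>d. (u + shift d, v - d)) ` contract U" by blast
    qed (use uv U in \<open>auto simp: contract_def vs.subspace_diff vs.subspace_add shift_linear\<close>)
    moreover have "inj_on (\<lambda>d. (u + shift d, v - d)) (contract U)"
      by (auto simp: inj_on_def)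
    ultimately show ?thesis by (simp add: card_image)
  qed
  have expand: "expand U = ?f ` (U \<times> U)"
    by (auto simp: expand_def set_plus_def)
  have finE: "finite (expand U)" and finC: "finite (contract U)"
    using fin by (auto simp: expand contract_def)
  have "card (U \<times> U) = (\<Sum>e\<in>expand U. card {p \<in> U \<times> U. ?f p = e})"
    using sum.group[of "U \<times> U" "expand U" ?f "\<lambda>_. 1 :: nat"] fin finE by (simp add: expand)
  also have "\<dots> = card (expand U) * card (contract U)"
    using fibre by simp
  finally have "CARD('k) ^ (2 * vs.dim U) = CARD('k) ^ (vs.dim (expand U) + vs.dim (contract U))"
    using U fin finE finC
    by (simp add: card_cartesian_product vs.card_subspace subspace_expand subspace_contract
        power_add mult_2)
  then show ?thesis using card_field_gt_1[where 'k='k] by simp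
qed

section \<open>Submodules of P_n as pairs of coordinate subspaces\<close>

definition subspaces :: "nat \<Rightarrow> nat \<Rightarrow> (nat \<Rightarrow> 'k::field) set set" where
  "subspaces m d = {U. vs.subspace U \<and> U \<subseteq> coord_space m \<and> vs.dim U = d}"

lemma finite_subspaces [simp]: "finite (subspaces m d :: (nat \<Rightarrow> 'k::{field,finite}) set set)"
  by (rule finite_subset[of _ "Pow (coord_space m)"]) (auto simp: subspaces_def)

lemma subspacesD:
  fixes U :: "(nat \<Rightarrow> 'k::{field,finite}) set"
  assumes "U \<in> subspaces m d"
  shows "vs.subspace U" "finite U" "U \<subseteq> coord_space m" "vs.dim U = d"
  using assms finite_subset[OF _ finite_coord_space] by (auto simp: subspaces_def)

lemma P_submodule_iff:
  "P_submodule n U \<longleftrightarrow> vs.subspace (fst U) \<and> fst U \<subseteq> coord_space (n + 1) \<and>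
     vs.subspace (snd U) \<and> snd U \<subseteq> coord_space n \<and> expand (snd U) \<subseteq> fst U"
proof (cases "snd U \<subseteq> coord_space n")
  case True
  then have "P_alpha n ` snd U = id ` snd U" "P_beta n ` snd U = shift ` snd U"
    by (intro image_cong; auto simp: P_alpha_eq P_beta_eq)+
  then show ?thesis by (simp only: P.submodule_def expand_def image_id id_apply)
qed (simp add: P.submodule_def)

lemma P_Gr_eq:
  "P_Gr n (int a, int b) =
    (SIGMA U\<^sub>1 : subspaces (n + 1) a. {U\<^sub>2 \<in> subspaces n b. expand U\<^sub>2 \<subseteq> U\<^sub>1})"
proof (rule set_eqI)
  fix U :: "(nat \<Rightarrow> 'a) set \<times> (nat \<Rightarrow> 'a) set"
  obtain U\<^sub>1 U\<^sub>2 where U: "U = (U\<^sub>1, U\<^sub>2)" by fastforce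
  show "U \<in> P_Gr n (int a, int b) \<longleftrightarrow>
      U \<in> (SIGMA U\<^sub>1 : subspaces (n + 1) a. {U\<^sub>2 \<in> subspaces n b. expand U\<^sub>2 \<subseteq> U\<^sub>1})"
    unfolding P.Gr_def P.dim_vector_def P_submodule_iff subspaces_def mem_Collect_eq
      mem_Sigma_iff U fst_conv snd_conv prod.inject of_nat_eq_iff
    by argo
qed

subsection \<open>The recursion\<close>

text \<open>The closed form of N_n(b, r) for b \<ge> 1. The value 0 at r = 0 reflects that no
  nonzero finite-dimensional space of polynomials is stable under x; for b = 0 the true count at r =
  0 is 1.\<close>

definition expansion_number :: "'a::field \<Rightarrow> nat \<Rightarrow> nat \<Rightarrow> nat \<Rightarrow> 'a" where
  "expansion_number q n b r =
    (if r = 0 then 0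
     else q ^ (r * (r - 1)) * qbinom q (b - 1) (r - 1) * qbinom q (n + 1 - b) r)"

text \<open>Trinomial revision extracts the first factor of the result, and q-Vandermonde with upper
  indices b - 1 and a - b sums the rest. The guard is needed because a truncated a - (b + r) would
  make the last coefficient 1.\<close>

lemma sum_expansion_number_expand:
  fixes q :: "'a::linordered_field"
  assumes q: "q > 1" and b: "b \<ge> 1"
  shows "(\<Sum>r\<le>b. expansion_number q n b r *
      (if b + r \<le> a then qbinom q (n + 1 - (b + r)) (a - (b + r)) else 0)) =
    qbinom q (n + 1 - b) (a - b) * qbinom q (a - 1) b"
proof (cases "a \<le> b")
  case True
  then have "expansion_number q n b r *
      (if b + r \<le> a then qbinom q (n + 1 - (b + r)) (a - (b + r)) else 0) = 0" for r
    using True by (simp add: expansion_number_def)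
  moreover have "qbinom q (a - 1) b = 0" using True b by simp
  ultimately show ?thesis by (simp only: sum.neutral_const mult_zero_right)
next
  case False
  have "expansion_number q n b r *
      (if b + r \<le> a then qbinom q (n + 1 - (b + r)) (a - (b + r)) else 0) =
    qbinom q (n + 1 - b) (a - b) *
      (q ^ (r * (b - 1 - (b - r))) * qbinom q (b - 1) (b - r) * qbinom q (a - b) r)"
    if "r \<le> b" for r
  proof (cases "r = 0 \<or> a < b + r")
    case True
    with b False that show ?thesis by (auto simp: expansion_number_def)
  next
    case r: False
    have "qbinom q (b - 1) (b - r) = qbinom q (b - 1) (r - 1)"
      using qbinom_symmetric[of "r - 1" "b - 1" q] r that by simp
    moreover have "r \<le> a - b" using r by linarith
    then have "qbinom q (n + 1 - b) (a - b) * qbinom q (a - b) r =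
        qbinom q (n + 1 - b) r * qbinom q (n + 1 - (b + r)) (a - (b + r))"
      using qbinom_trinomial_revision[OF q, of r "a - b" "n + 1 - b"] r by (simp add: not_less)
    moreover have "b - 1 - (b - r) = r - 1" using that by simp
    ultimately show ?thesis
      using r by (simp add: expansion_number_def mult_ac)
  qed
  then have "(\<Sum>r\<le>b. expansion_number q n b r *
      (if b + r \<le> a then qbinom q (n + 1 - (b + r)) (a - (b + r)) else 0)) =
    qbinom q (n + 1 - b) (a - b) * qbinom q (b - 1 + (a - b)) b"
    by (simp add: qbinom_Vandermonde[OF q] sum_distrib_left)
  with False b show ?thesis by simp
qed

text \<open>Here trinomial revision extracts \<open>qbinom q (a - 1) b\<close>, and q-Vandermonde
  has upper indices a - 1 - b and n + 2 - a. That the result agrees with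
  \<open>sum_expansion_number_expand\<close> is what makes the recursion close.\<close>

lemma sum_expansion_number_contract:
  fixes q :: "'a::linordered_field"
  assumes q: "q > 1" and a: "a \<ge> 1"
  shows "(\<Sum>d\<le>a. expansion_number q (n + 1) a (a - d) * qbinom q d b) =
    qbinom q (n + 1 - b) (a - b) * qbinom q (a - 1) b"
proof -
  have "(\<Sum>d\<le>a. expansion_number q (n + 1) a (a - d) * qbinom q d b) =
      (\<Sum>r\<le>a. expansion_number q (n + 1) a r * qbinom q (a - r) b)"
    by (rule sum.reindex_bij_witness[of _ "\<lambda>r. a - r" "\<lambda>d. a - d"]) auto
  also have "\<dots> = qbinom q (n + 1 - b) (a - b) * qbinom q (a - 1) b"
  \<comment> \<open>Outside this range both sides vanish; inside it the subtractions are exact, so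
    the Vandermonde indices add up to n + 1 - b.\<close>
  proof (cases "b < a \<and> a \<le> n + 2")
    case False
    then have "expansion_number q (n + 1) a r * qbinom q (a - r) b = 0" for r
      using a by (cases "r = 0"; cases "b < a") (simp_all add: expansion_number_def)
    moreover have "qbinom q (n + 1 - b) (a - b) * qbinom q (a - 1) b = 0"
      using False a by (cases "b < a") simp_all
    ultimately show ?thesis by (simp only: sum.neutral_const)
  next
    case True
    have "(\<Sum>r\<le>a. expansion_number q (n + 1) a r * qbinom q (a - r) b) =
        (\<Sum>r\<le>a - b. expansion_number q (n + 1) a r * qbinom q (a - r) b)"
      by (rule sum.mono_neutral_right) (use True in auto)
    also have "\<dots> = (\<Sum>r\<le>a - b. qbinom q (a - 1) b *
      (q ^ (r * (a - 1 - b - (a - b - r))) * qbinom q (a - 1 - b) (a - b - r) *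
        qbinom q (n + 2 - a) r))"
    proof (rule sum.cong)
      fix r assume "r \<in> {..a - b}"
      then have le: "b \<le> a - r" "r \<le> a" using True by auto
      show "expansion_number q (n + 1) a r * qbinom q (a - r) b = qbinom q (a - 1) b *
        (q ^ (r * (a - 1 - b - (a - b - r))) * qbinom q (a - 1 - b) (a - b - r) *
          qbinom q (n + 2 - a) r)"
      proof (cases "r = 0")
        case r: True
        have "qbinom q (a - 1 - b) (a - b - r) = 0"
          using r True by (intro qbinom_eq_0) linarith
        with r show ?thesis
          by (simp only: expansion_number_def mult_zero_left mult_zero_right simp_thms if_True)
      next
        case False
        have "qbinom q (a - 1) (a - r) = qbinom q (a - 1) (r - 1)"
          using qbinom_symmetric[of "r - 1" "a - 1" q] False le by simp
        moreover have "qbinom q (a - 1) (a - r) * qbinom q (a - r) b =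
            qbinom q (a - 1) b * qbinom q (a - 1 - b) (a - r - b)"
          by (rule qbinom_trinomial_revision[OF q le(1)])
        moreover have "a - 1 - b - (a - b - r) = r - 1" "a - r - b = a - b - r"
          using False le by auto
        ultimately show ?thesis
          using False by (simp add: expansion_number_def mult_ac)
      qed
    qed simp
    also have "\<dots> = qbinom q (a - 1) b * qbinom q (a - 1 - b + (n + 2 - a)) (a - b)"
      unfolding qbinom_Vandermonde[OF q] sum_distrib_left ..
    also have "a - 1 - b + (n + 2 - a) = n + 1 - b" using True by linarith
    finally show ?thesis by (simp only: mult.commute)
  qed
  finally show ?thesis .
qed

lemma sum_by_fibre:
  fixes h :: "'b \<Rightarrow> 'c::semiring_1"
  assumes "finite A" "finite B" "f ` A \<subseteq> B"
  shows "(\<Sum>x\<in>A. h (f x)) = (\<Sum>y\<in>B. of_nat (card {x \<in> A. f x = y}) * h y)"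
proof -
  have "(\<Sum>x\<in>A. h (f x)) = (\<Sum>y\<in>B. \<Sum>x\<in>{x \<in> A. f x = y}. h (f x))"
    using sum.group[OF assms, of "\<lambda>x. h (f x)"] by simp
  also have "\<dots> = (\<Sum>y\<in>B. of_nat (card {x \<in> A. f x = y}) * h y)"
    by (rule sum.cong) auto
  finally show ?thesis .
qed

section \<open>Double counting of submodules and induction on n\<close>

context
  fixes q :: rat
  assumes q_def: "q = of_nat CARD('k::{field,finite})"
begin

lemma q_gt_1: "q > 1"
  using card_field_gt_1[where 'k='k] by (simp add: q_def)

lemma dim_expand_bounds:
  fixes U :: "(nat \<Rightarrow> 'k) set"
  assumes "U \<in> subspaces m d"
  shows "d \<le> vs.dim (expand U)" "vs.dim (expand U) \<le> 2 * d" "vs.dim (contract U) \<le> d"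
proof -
  note U = subspacesD[OF assms]
  show "vs.dim (contract U) \<le> d"
    using vs.dim_mono_finite[OF subspace_contract[OF U(1)] U(1,2)] U(4)
    by (simp add: contract_def)
  with dim_expand_plus_dim_contract[OF U(1,2)] U(4)
  show "d \<le> vs.dim (expand U)" "vs.dim (expand U) \<le> 2 * d" by simp_all
qed

lemma card_P_Gr_expand:
  "(of_nat (card (P_Gr n (int a, int b) :: ((nat \<Rightarrow> 'k) set \<times> (nat \<Rightarrow> 'k) set) set)) :: rat) =
    (\<Sum>r\<le>b. of_nat (card {U \<in> subspaces n b :: (nat \<Rightarrow> 'k) set set. vs.dim (expand U) = b + r}) *
      (if b + r \<le> a then qbinom q (n + 1 - (b + r)) (a - (b + r)) else 0))"
proof -
  let ?h = "\<lambda>e. if e \<le> a then qbinom q (n + 1 - e) (a - e) else 0"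
  let ?S1 = "subspaces (n + 1) a :: (nat \<Rightarrow> 'k) set set"
  let ?S2 = "subspaces n b :: (nat \<Rightarrow> 'k) set set"
  have "(of_nat (card (P_Gr n (int a, int b) :: ((nat \<Rightarrow> 'k) set \<times> (nat \<Rightarrow> 'k) set) set)) :: rat) =
      (\<Sum>U\<^sub>1\<in>?S1. \<Sum>U\<^sub>2 | U\<^sub>2 \<in> ?S2 \<and> expand U\<^sub>2 \<subseteq> U\<^sub>1. 1)"
    unfolding P_Gr_eq by (subst card_SigmaI) simp_all
  also have "\<dots> = (\<Sum>U\<^sub>2\<in>?S2. \<Sum>U\<^sub>1 | U\<^sub>1 \<in> ?S1 \<and> expand U\<^sub>2 \<subseteq> U\<^sub>1. 1)"
    by (rule sum.swap_restrict) simp_all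
  also have "\<dots> = (\<Sum>U\<^sub>2\<in>?S2. ?h (b + (vs.dim (expand U\<^sub>2) - b)))"
  proof (rule sum.cong)
    fix U\<^sub>2 assume U\<^sub>2: "U\<^sub>2 \<in> ?S2"
    note U = subspacesD[OF this]
    have eq: "{U\<^sub>1. U\<^sub>1 \<in> ?S1 \<and> expand U\<^sub>2 \<subseteq> U\<^sub>1} =
        {U. vs.subspace U \<and> expand U\<^sub>2 \<subseteq> U \<and> U \<subseteq> coord_space (n + 1) \<and> vs.dim U = a}"
      by (auto simp: subspaces_def)
    have "(of_nat (card {U\<^sub>1. U\<^sub>1 \<in> ?S1 \<and> expand U\<^sub>2 \<subseteq> U\<^sub>1}) :: rat) = ?h (vs.dim (expand U\<^sub>2))"
    proof (cases "vs.dim (expand U\<^sub>2) \<le> a")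
      case True
      from vs.card_subspaces_between[OF subspace_expand[OF U(1)] subspace_coord_space
          finite_coord_space expand_subset_coord_space[OF U(1,3)] this]
      show ?thesis
        using True unfolding eq by (simp only: dim_coord_space q_def if_True)
    next
      case False
      have "{U\<^sub>1. U\<^sub>1 \<in> ?S1 \<and> expand U\<^sub>2 \<subseteq> U\<^sub>1} = {}"
      proof (intro equals0I, elim CollectE conjE)
        fix U\<^sub>1 assume "U\<^sub>1 \<in> ?S1" "expand U\<^sub>2 \<subseteq> U\<^sub>1"
        with vs.dim_mono_finite[OF subspace_expand[OF U(1)]] subspacesD[of U\<^sub>1] False
        show False by metis
      qed
      with False show ?thesis by simp
    qed
    with dim_expand_bounds(1)[OF U\<^sub>2]
    show "(\<Sum>U\<^sub>1 | U\<^sub>1 \<in> ?S1 \<and> expand U\<^sub>2 \<subseteq> U\<^sub>1. 1) = ?h (b + (vs.dim (expand U\<^sub>2) - b))"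
      by simp
  qed simp
  also have "\<dots> = (\<Sum>r\<le>b. of_nat (card {U \<in> ?S2. vs.dim (expand U) - b = r}) * ?h (b + r))"
    by (rule sum_by_fibre) (use dim_expand_bounds(2) in \<open>fastforce+\<close>)
  also have "\<dots> = (\<Sum>r\<le>b. of_nat (card {U \<in> ?S2. vs.dim (expand U) = b + r}) * ?h (b + r))"
  proof (intro sum.cong refl arg_cong2[of _ _ _ _ "(*)"] arg_cong[of _ _ of_nat] arg_cong[of _ _ card])
    fix r
    show "{U \<in> ?S2. vs.dim (expand U) - b = r} = {U \<in> ?S2. vs.dim (expand U) = b + r}"
      using dim_expand_bounds(1)[of _ n b] by force
  qed
  finally show ?thesis .
qed

lemma card_P_Gr_contract:
  "(of_nat (card (P_Gr n (int a, int b) :: ((nat \<Rightarrow> 'k) set \<times> (nat \<Rightarrow> 'k) set) set)) :: rat) =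
    (\<Sum>d\<le>a. of_nat (card {U \<in> subspaces (n + 1) a :: (nat \<Rightarrow> 'k) set set. vs.dim (contract U) = d}) *
      qbinom q d b)"
proof -
  let ?S1 = "subspaces (n + 1) a :: (nat \<Rightarrow> 'k) set set"
  let ?S2 = "subspaces n b :: (nat \<Rightarrow> 'k) set set"
  have "(of_nat (card (P_Gr n (int a, int b) :: ((nat \<Rightarrow> 'k) set \<times> (nat \<Rightarrow> 'k) set) set)) :: rat) =
      (\<Sum>U\<^sub>1\<in>?S1. of_nat (card {U\<^sub>2 \<in> ?S2. expand U\<^sub>2 \<subseteq> U\<^sub>1}))"
    unfolding P_Gr_eq by (subst card_SigmaI) simp_all
  also have "\<dots> = (\<Sum>U\<^sub>1\<in>?S1. qbinom q (vs.dim (contract U\<^sub>1)) b)"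
  proof (rule sum.cong)
    fix U\<^sub>1 assume "U\<^sub>1 \<in> ?S1"
    note U = subspacesD[OF this]
    \<comment> \<open>By the adjunction the condition is containment in
      \<open>contract U\<^sub>1\<close>, which already lies in k^n.\<close>
    have "{U\<^sub>2 \<in> ?S2. expand U\<^sub>2 \<subseteq> U\<^sub>1} =
        {U. vs.subspace U \<and> U \<subseteq> contract U\<^sub>1 \<and> vs.dim U = b}"
      using contract_subset_coord_space[OF U(3)] expand_subset_iff[OF _ U(1)]
      by (auto simp: subspaces_def)
    moreover have "finite (contract U\<^sub>1)" using U(2) by (simp add: contract_def)
    ultimately show "of_nat (card {U\<^sub>2 \<in> ?S2. expand U\<^sub>2 \<subseteq> U\<^sub>1}) =
        qbinom q (vs.dim (contract U\<^sub>1)) b"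
      using vs.card_subspaces[OF subspace_contract[OF U(1)]] by (simp only: q_def)
  qed simp
  also have "\<dots> = (\<Sum>d\<le>a. of_nat (card {U \<in> ?S1. vs.dim (contract U) = d}) * qbinom q d b)"
    by (rule sum_by_fibre) (use dim_expand_bounds(3) in \<open>fastforce+\<close>)
  finally show ?thesis .
qed

text \<open>Stated conditionally so that it serves inside the induction of
  \<open>card_expansion\<close>, fed by the induction hypothesis, and again for the final
  count.\<close>

lemma card_P_Gr_if_expansion:
  assumes "\<And>b r. b \<ge> 1 \<Longrightarrow>
    (of_nat (card {U \<in> subspaces n b :: (nat \<Rightarrow> 'k) set set. vs.dim (expand U) = b + r}) :: rat) =
      expansion_number q n b r"
  shows "(of_nat (card (P_Gr n (int a, int b) :: ((nat \<Rightarrow> 'k) set \<times> (nat \<Rightarrow> 'k) set) set)) :: rat) =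
    qbinom q (n + 1 - b) (a - b) * qbinom q (a - 1) b"
proof (cases "b = 0")
  \<comment> \<open>\<open>expansion_number\<close> does not cover b = 0; there only r = 0 occurs,
    with the zero subspace as the single contribution.\<close>
  case True
  have "{U \<in> subspaces n 0 :: (nat \<Rightarrow> 'k) set set. vs.dim (expand U) = 0} =
      {U. vs.subspace U \<and> U \<subseteq> coord_space n \<and> vs.dim U = 0}"
    using dim_expand_bounds(2)[of _ n 0] by (auto simp: subspaces_def)
  then have "(of_nat (card {U \<in> subspaces n 0 :: (nat \<Rightarrow> 'k) set set. vs.dim (expand U) = 0}) :: rat) = 1"
    using vs.card_subspaces[OF subspace_coord_space finite_coord_space, of n 0, where 'k='k]
    by (simp add: q_gt_1 flip: q_def)
  then show ?thesis
    unfolding card_P_Gr_expand True by (cases "a \<le> n + 1") (simp_all add: q_gt_1)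
next
  case False
  then show ?thesis
    unfolding card_P_Gr_expand using sum_expansion_number_expand[OF q_gt_1, of b n a]
    by (simp add: assms)
qed

lemma card_expansion:
  assumes "b \<ge> 1"
  shows "(of_nat (card {U \<in> subspaces n b :: (nat \<Rightarrow> 'k) set set. vs.dim (expand U) = b + r}) :: rat) =
    expansion_number q n b r"
  using assms
proof (induction n arbitrary: b r)
  case 0
  have "vs.dim U = 0" if "U \<in> subspaces 0 b" for U :: "(nat \<Rightarrow> 'k) set"
    using vs.dim_mono_finite[OF subspacesD(1)[OF that] subspace_coord_space finite_coord_space
        subspacesD(3)[OF that]] unfolding dim_coord_space by simp
  then have "subspaces 0 b = ({} :: (nat \<Rightarrow> 'k) set set)"
    using 0 by (force simp: subspaces_def)
  with 0 show ?case by (simp add: expansion_number_def)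
next
  case (Suc n a r)
  let ?S = "subspaces (n + 1) a :: (nat \<Rightarrow> 'k) set set"
  let ?M = "\<lambda>d. of_nat (card {U \<in> ?S. vs.dim (contract U) = d}) :: rat"
  \<comment> \<open>Both families have the same q-binomial transform, namely the submodule count of
    P_n given by the induction hypothesis.\<close>
  have M: "?M d = expansion_number q (n + 1) a (a - d)" if "d \<le> a" for d
  proof (rule qbinom_transform_inject[OF q_gt_1 _ that])
    fix b
    show "(\<Sum>d\<le>a. ?M d * qbinom q d b) =
        (\<Sum>d\<le>a. expansion_number q (n + 1) a (a - d) * qbinom q d b)"
      unfolding card_P_Gr_contract[symmetric] sum_expansion_number_contract[OF q_gt_1 Suc.prems]
      by (rule card_P_Gr_if_expansion) (rule Suc.IH)
  qed
  have dim: "vs.dim (expand U) + vs.dim (contract U) = 2 * a" if "U \<in> ?S" for U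
    using dim_expand_plus_dim_contract subspacesD[OF that] by blast
  show ?case
  proof (cases "r \<le> a")
    case True
    \<comment> \<open>The dimension formula trades an excess r of \<open>expand\<close> for a
      deficit r of \<open>contract\<close>.\<close>
    have "{U \<in> ?S. vs.dim (expand U) = a + r} = {U \<in> ?S. vs.dim (contract U) = a - r}"
      using dim True by force
    with M[of "a - r"] True show ?thesis by simp
  next
    case False
    then have "{U \<in> ?S. vs.dim (expand U) = a + r} = {}"
      using dim by force
    with False Suc.prems show ?thesis by (simp add: expansion_number_def)
  qed
qed

lemma card_P_Gr:
  "(of_nat (card (P_Gr n (int a, int b) :: ((nat \<Rightarrow> 'k) set \<times> (nat \<Rightarrow> 'k) set) set)) :: rat) =
    qbinom q (n + 1 - b) (a - b) * qbinom q (a - 1) b"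
  by (rule card_P_Gr_if_expansion) (rule card_expansion)

end

theorem theorem4p1:
  fixes n :: nat and a b :: int and q :: nat
  assumes "q = CARD('k::{field,finite})"
  shows "of_nat (card (P_Gr n (a, b) :: ((nat \<Rightarrow> 'k) set \<times> (nat \<Rightarrow> 'k) set) set)) =
    (if a < 0 \<or> b < 0 then 0
     else if a = 0 \<and> b = 0 then 1
     else gaussian (int n + 1 - a) (int n + 1 - b) (of_nat q) *
          gaussian (a - b - 1) (a - 1) (of_nat q) :: rat)"
proof (cases "a < 0 \<or> b < 0")
  case True
  then have "P_Gr n (a, b) = ({} :: ((nat \<Rightarrow> 'k) set \<times> (nat \<Rightarrow> 'k) set) set)"
    by (auto simp: P.Gr_def P.dim_vector_def)
  with True show ?thesis by simp
next
  case False
  then obtain c d where cd: "a = int c" "b = int d"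
    by (metis not_less zero_le_imp_eq_int)
  let ?q = "of_nat q :: rat"
  have q: "?q > 1" using card_field_gt_1[where 'k='k] assms by simp
  have card: "of_nat (card (P_Gr n (a, b) :: ((nat \<Rightarrow> 'k) set \<times> (nat \<Rightarrow> 'k) set) set)) =
      qbinom ?q (n + 1 - d) (c - d) * qbinom ?q (c - 1) d"
    unfolding cd assms by (rule card_P_Gr) simp
  \<comment> \<open>At c = d = 0 truncated subtraction makes the \<open>qbinom\<close> product 1. In
    the next two cases a Gaussian coefficient has negative upper index and a \<open>qbinom\<close>
    factor vanishes. In the last all indices are natural numbers, and symmetry matches the
    factors.\<close>
  consider "c = 0" "d = 0" | "c \<le> d" "d > 0" | "d < c" "c > n + 1" | "d < c" "c \<le> n + 1"
    by linarith
  then show ?thesis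
  proof cases
    case 1
    with card cd q show ?thesis by simp
  next
    case 2
    with card cd show ?thesis by (simp add: gaussian_def)
  next
    case 3
    with card cd show ?thesis by (simp add: gaussian_def)
  next
    case 4
    then have eqs: "int n + 1 - a = int (n + 1 - c)" "int n + 1 - b = int (n + 1 - d)"
      "a - b - 1 = int (c - 1 - d)" "a - 1 = int (c - 1)"
      using cd by auto
    have "qbinom ?q (n + 1 - d) (n + 1 - c) = qbinom ?q (n + 1 - d) (c - d)"
      using qbinom_symmetric[of "c - d" "n + 1 - d" ?q] 4 by simp
    moreover have "qbinom ?q (c - 1) (c - 1 - d) = qbinom ?q (c - 1) d"
      using qbinom_symmetric[of d "c - 1" ?q] 4 by simp
    moreover have "\<not> (a = 0 \<and> b = 0)" using 4 cd by simp
    ultimately show ?thesis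
      using False by (simp only: card eqs gaussian_eq_qbinom[OF q] if_False)
  qed
qed

end
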